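(* Let $1\le \ell_1\le k_1$ and $\ell_2\ge 1$ be integers, let $0<p<1$, $q=1-p$, and put $a(p)=q^{\ell_1}p^{\ell_2}$, $\ell=\ell_1+\ell_2$, $m_1=k_1-\ell_1+1$. Let $\rho_r$ be the waiting time, in a sequence of independent Bernoulli($p$) trials, for the $r$-th occurrence of the pattern "at least $\ell_1$ and at most $k_1$ consecutive 0's followed by at least $\ell_2$ consecutive 1's". Let $H_r(t)=E[t^{\rho_r}]$, $g_r(m)=P(\rho_r=m)$ and $\tilde\mu_{r,j}=E[\rho_r^{\,j}]$. Let $\delta_{i,j}$ be the Kronecker delta. Then, for all $r\ge1$: (i) $\displaystyle H_r(t)=\left(\frac{a(p)t^\ell(1-(qt)^{m_1})}{1-t+a(p)t^\ell(1-(qt)^{m_1})}\right)^r$ for $|t|\le 1$. (ii) For $m\ge \ell r$, $g_r(m)=g_r(m-1)+a(p)\left[g_{r-1}(m-\ell)-g_r(m-\ell)-q^{m_1}\big(g_{r-1}(m-\ell-m_1)-g_r(m-\ell-m_1)\big)\right]$, with initial conditions $g_0(m)=\delta_{m,0}$ and $g_r(m)=0$ for $m\le \ell r-1$. (iii) For $j\ge1$, $\displaystyle \tilde\mu_{r,j}=\sum_{k=0}^{j}\binom{j}{k}\left[\tilde\mu_{r,k}+a(p)\left(\ell^{j-k}-q^{m_1}(\ell+m_1)^{j-k}\right)(\tilde\mu_{r-1,k}-\tilde\mu_{r,k})\right]$, with initial condition $\tilde\mu_{0,i}=\delta_{i,0}$.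
   Context: Let $\zeta_1,\zeta_2,\dots$ be independent with $P(\zeta_i=1)=p$ and $P(\zeta_i=0)=q=1-p$. $H^n_{\ell_1,k_1,\ell_2}$ is the number of occurrences of the following pattern within $\zeta_1,\dots,\zeta_n$: a maximal block of consecutive 0's (i.e. one starting at position 1 or immediately preceded by a 1, and ended by a 1) of length $j$ with $\ell_1\le j\le k_1$, immediately followed by at least $\ell_2$ consecutive 1's, where these first $\ell_2$ ones all lie in positions $\le n$. (The pattern is counted as soon as the $\ell_2$-th of these 1's occurs, and once per maximal block of 0's.) For example, for the sequence 00111101100010100011 of length 20, $H^{20}_{1,1,1}=2$, $H^{20}_{1,2,2}=2$, $H^{20}_{2,2,3}=1$, $H^{20}_{1,2,1}=3$. The $r$-th waiting time is $\rho_r=\min\{n\ge0: H^n_{\ell_1,k_1,\ell_2}=r\}$, with $\rho_0=0$. $g_r(m)$ is defined for all integers $m$ (zero for negative $m$). *)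

theory Defs
  imports "HOL-Probability.Probability"
begin

text \<open>
  Positions of a 0-1 sequence \<open>x\<close> are numbered from 1; the value \<open>x 0\<close> is never used.
  A maximal block of exactly \<open>j\<close> zeros starts at \<open>s\<close>; the \<open>1\<close> that ends the block is the first of
  the \<open>l2\<close> ones, so the pattern is complete at position \<open>s + j + l2 - 1\<close>.
  (For \<open>l2 \<ge> 1\<close>, which is assumed throughout, \<open>j\<close> is determined by \<open>x\<close> and \<open>s\<close>.)
\<close>

definition pattern_at :: "nat \<Rightarrow> (nat \<Rightarrow> nat) \<Rightarrow> nat \<Rightarrow> nat \<Rightarrow> bool" where
  "pattern_at l2 x s j \<longleftrightarrow>
     (s = 1 \<or> x (s - 1) = 1) \<and>
     (\<forall>i\<in>{s..<s + j}. x i = 0) \<and>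
     (\<forall>i\<in>{s + j..<s + j + l2}. x i = 1)"

definition pattern_count :: "nat \<Rightarrow> nat \<Rightarrow> nat \<Rightarrow> (nat \<Rightarrow> nat) \<Rightarrow> nat \<Rightarrow> nat" where
  "pattern_count l1 k1 l2 x n =
     card {s \<in> {1..n}. \<exists>j\<in>{l1..k1}. pattern_at l2 x s j \<and> s + j + l2 - 1 \<le> n}"

text \<open>The infimum of the empty set is \<open>\<infinity>\<close>: the \<open>r\<close>-th occurrence need not exist for every \<open>x\<close>.\<close>

definition waiting_time :: "nat \<Rightarrow> nat \<Rightarrow> nat \<Rightarrow> (nat \<Rightarrow> nat) \<Rightarrow> nat \<Rightarrow> enat" where
  "waiting_time l1 k1 l2 x r = Inf (enat ` {n. pattern_count l1 k1 l2 x n = r})"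

text \<open>
  The three quantities below describe an extended-natural-valued random variable \<open>N\<close>, with
  \<open>t ^ \<infinity> = 0\<close> in the generating function. The point mass takes an integer argument and is
  therefore \<open>0\<close> at negative ones.
\<close>

definition prob_gen_fun :: "'a measure \<Rightarrow> ('a \<Rightarrow> enat) \<Rightarrow> complex \<Rightarrow> complex" where
  "prob_gen_fun M N t = (\<integral>\<omega>. (case N \<omega> of enat n \<Rightarrow> t ^ n | \<infinity> \<Rightarrow> 0) \<partial>M)"

definition point_mass :: "'a measure \<Rightarrow> ('a \<Rightarrow> enat) \<Rightarrow> int \<Rightarrow> real" where
  "point_mass M N m = measure M {\<omega> \<in> space M. \<exists>n. N \<omega> = enat n \<and> int n = m}"

definition raw_moment :: "'a measure \<Rightarrow> ('a \<Rightarrow> enat) \<Rightarrow> nat \<Rightarrow> ennreal" where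
  "raw_moment M N j = (\<integral>\<^sup>+\<omega>. ennreal_of_enat (N \<omega>) ^ j \<partial>M)"

end

theory Submission
  imports Defs "HOL-Real_Asymp.Real_Asymp"
begin

text \<open>
  Let \<open>C\<^sub>n\<close> be the number of occurrences within the first \<open>n\<close> trials. The \<open>(r + 1)\<close>-st occurrence is
  completed at \<open>m\<close> iff the trials up to \<open>m\<close> end with at least \<open>l1\<close> zeros and \<open>l2\<close> ones, and had
  \<open>C = r\<close> before these \<open>l1 + l2\<close> trials, but do not end in the same way with \<open>k1 + 1\<close> zeros in place
  of \<open>l1\<close>. The second event is contained in the first, and both are independent of the earlier trials, so
  \<open>g\<^bsub>r+1\<^esub>(m) = a (P(C\<^bsub>m-l\<^esub> = r) - q\<^sup>m\<^sup>1 P(C\<^bsub>m-l-m1\<^esub> = r))\<close>.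
  Since \<open>P(C\<^sub>n = r) - P(C\<^bsub>n-1\<^esub> = r) = g\<^sub>r(n) - g\<^bsub>r+1\<^esub>(n)\<close>, differencing gives the recurrence (ii).
  The waiting times have geometric tails, so the recurrence may be summed against \<open>t\<^sup>n\<close> and
  \<open>n\<^sup>j\<close>, which gives (i) and (iii).
\<close>


section \<open>Occurrences in a fixed sequence\<close>

locale run_pattern =
  fixes l1 k1 l2 :: nat
  assumes l1_pos: "1 \<le> l1" and l1_le: "l1 \<le> k1" and l2_pos: "1 \<le> l2"
begin

abbreviation cnt :: "(nat \<Rightarrow> nat) \<Rightarrow> nat \<Rightarrow> nat" where
  "cnt \<equiv> pattern_count l1 k1 l2"

text \<open>The event at which the count jumps. A bound \<open>s \<le> n\<close> is implied, since
  \<open>j\<close> and \<open>l2\<close> are positive.\<close>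

definition completes :: "(nat \<Rightarrow> nat) \<Rightarrow> nat \<Rightarrow> bool" where
  "completes x n \<longleftrightarrow> (\<exists>s\<ge>1. \<exists>j\<in>{l1..k1}. pattern_at l2 x s j \<and> s + j + l2 - 1 = n)"

text \<open>Unlike \<open>pattern_at\<close>, this leaves position \<open>n\<close> free, so the
  zeros may extend further to the left. It therefore constrains only trials after \<open>n\<close>
  and is independent of the first \<open>n\<close> trials.\<close>

definition run_then_ones :: "(nat \<Rightarrow> nat) \<Rightarrow> nat \<Rightarrow> nat \<Rightarrow> bool" where
  "run_then_ones x n i \<longleftrightarrow>
     (\<forall>k\<in>{n<..n + (i + l2)}. x k = (if k \<le> n + i then 0 else 1))"

lemma pattern_at_first_one: "pattern_at l2 x s j \<Longrightarrow> x (s + j) = 1"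
  using l2_pos by (auto simp: pattern_at_def)

lemma pattern_at_zero: "pattern_at l2 x s j \<Longrightarrow> s \<le> i \<Longrightarrow> i < s + j \<Longrightarrow> x i = 0"
  by (auto simp: pattern_at_def)

lemma pattern_at_length_unique:
  assumes "pattern_at l2 x s j" "pattern_at l2 x s j'"
  shows "j = j'"
proof (rule linorder_cases[of j j'])
  assume "j < j'"
  then show ?thesis
    using pattern_at_first_one[OF assms(1)] pattern_at_zero[OF assms(2), of "s + j"] by simp
next
  assume "j' < j"
  then show ?thesis
    using pattern_at_first_one[OF assms(2)] pattern_at_zero[OF assms(1), of "s + j'"] by simp
qed

text \<open>With a common end, the later start is preceded by a position that lies inside the longer
  block. That position would have to be both 0 and 1.\<close>

lemma pattern_at_start_unique:
  assumes "pattern_at l2 x s j" "pattern_at l2 x s' j'" "s + j = s' + j'" "1 \<le> s" "1 \<le> s'"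
  shows "s = s'"
proof -
  have "\<not> s < s'" if "pattern_at l2 x s j" "pattern_at l2 x s' j'" "s + j = s' + j'" "1 \<le> s"
    for s s' j j'
  proof
    assume "s < s'"
    then have "x (s' - 1) = 1" using that by (auto simp: pattern_at_def)
    moreover have "x (s' - 1) = 0"
      using pattern_at_zero[OF that(1), of "s' - 1"] that \<open>s < s'\<close> by linarith
    ultimately show False by simp
  qed
  then show ?thesis using assms by (metis linorder_neqE_nat)
qed

lemma cnt_0 [simp]: "cnt x 0 = 0"
  by (simp add: pattern_count_def)

text \<open>The starts counted at \<open>Suc n\<close> are those already complete by
  \<open>n\<close> and those completed exactly at \<open>Suc n\<close>. The end of the zero block is
  fixed by the completion time, so there is at most one start of the second kind.\<close>

lemma cnt_Suc: "cnt x (Suc n) = cnt x n + of_bool (completes x (Suc n))"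
proof -
  let ?S = "\<lambda>n. {s \<in> {1..n}. \<exists>j\<in>{l1..k1}. pattern_at l2 x s j \<and> s + j + l2 - 1 \<le> n}"
  let ?N = "{s. 1 \<le> s \<and> (\<exists>j\<in>{l1..k1}. pattern_at l2 x s j \<and> s + j + l2 - 1 = Suc n)}"
  have split: "?S (Suc n) = ?S n \<union> ?N"
    using l1_pos l2_pos by (auto simp: le_Suc_eq) 
  \<comment> \<open>A start in both sets would have two block lengths, with different completion
    times.\<close>
  have disj: "?S n \<inter> ?N = {}"
    using pattern_at_length_unique by fastforce
  have N: "card ?N = of_bool (completes x (Suc n))"
  proof (cases "completes x (Suc n)")
    case True
    then obtain s where s: "s \<in> ?N" unfolding completes_def by blast
    have "?N = {s}"
    proof (intro equalityI subsetI)
      fix s' assume "s' \<in> ?N"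
      with s obtain j j' where "pattern_at l2 x s j" "pattern_at l2 x s' j'" "s + j = s' + j'"
        "1 \<le> s" "1 \<le> s'" by force
      then show "s' \<in> {s}" using pattern_at_start_unique by blast
    qed (use s in auto)
    then show ?thesis using True by simp
  next
    case False
    then have "?N = {}" unfolding completes_def by blast
    then show ?thesis using False by (simp only: card.empty of_bool_eq)
  qed
  have "finite ?N"
    by (rule finite_subset[of _ "{1..Suc n}"]) (use l2_pos in auto)
  then have "card (?S (Suc n)) = card (?S n) + card ?N"
    unfolding split using disj by (intro card_Un_disjoint) auto
  then show ?thesis using N by (simp only: pattern_count_def)
qed

lemma mono_cnt: "mono (cnt x)"
  by (intro mono_iff_le_Suc[THEN iffD2] allI) (simp add: cnt_Suc)

lemma completes_ones:
  assumes "completes x n" "n < i + l2" "i \<le> n"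
  shows "x i = 1"
  using assms unfolding completes_def pattern_at_def by force

lemma cnt_constI:
  assumes "n \<le> m" "\<And>i. n < i \<Longrightarrow> i \<le> m \<Longrightarrow> \<not> completes x i"
  shows "cnt x m = cnt x n"
  using assms by (induction m rule: dec_induct) (auto simp: cnt_Suc)

section \<open>Waiting times in terms of the count\<close>

lemma waiting_time_0: "waiting_time l1 k1 l2 x 0 = 0"
  unfolding waiting_time_def by (metis (mono_tags, lifting) cnt_0 enat_0 image_eqI mem_Collect_eq
    Inf_lower le_zero_eq)

text \<open>The count is nondecreasing with steps of at most 1, so it first equals
  \<open>Suc r\<close> exactly at a completion before which it was \<open>r\<close>.\<close>

lemma waiting_time_Suc_eq_iff:
  "waiting_time l1 k1 l2 x (Suc r) = enat m \<longleftrightarrow> 0 < m \<and> completes x m \<and> cnt x (m - 1) = r"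
proof -
  \<comment> \<open>A finite infimum in \<open>enat\<close> is attained, and the empty set has
    infimum \<open>\<infinity>\<close>.\<close>
  have inf: "Inf (enat ` A) = enat m \<longleftrightarrow> m \<in> A \<and> (\<forall>n\<in>A. m \<le> n)" for A m
  proof 
    assume eq: "Inf (enat ` A) = enat m"
    then have "A \<noteq> {}" by (auto simp: top_enat_def)
    then have "Inf (enat ` A) \<in> enat ` A" by (metis Inf_enat_def LeastI_ex empty_is_image ex_in_conv)
    then show "m \<in> A \<and> (\<forall>n\<in>A. m \<le> n)"
      using eq by (metis Inf_lower enat.inject enat_ord_simps(1) image_iff)
  next
    assume "m \<in> A \<and> (\<forall>n\<in>A. m \<le> n)"
    then show "Inf (enat ` A) = enat m"
      by (intro antisym Inf_lower Inf_greatest) auto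
  qed
  show ?thesis
  proof (cases m)
    case 0
    then show ?thesis by (auto simp: waiting_time_def inf)
  next
    case (Suc k)
    have "(cnt x (Suc k) = Suc r \<and> (\<forall>n. cnt x n = Suc r \<longrightarrow> Suc k \<le> n)) \<longleftrightarrow>
      completes x (Suc k) \<and> cnt x k = r" (is "?L \<longleftrightarrow> ?R")
    proof
      assume L: ?L
      then have "cnt x k \<noteq> Suc r" by (meson Suc_n_not_le_n)
      then show ?R using L cnt_Suc[of x k] by (auto split: if_splits simp: of_bool_def)
    next
      assume R: ?R
      have "Suc k \<le> n" if "cnt x n = Suc r" for n
      proof (rule ccontr)
        assume "\<not> Suc k \<le> n"
        then have "cnt x n \<le> cnt x k" using monoD[OF mono_cnt] by simp
        with that R show False by simp
      qed
      then show ?L using R cnt_Suc[of x k] by simp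
    qed
    then show ?thesis by (simp add: waiting_time_def inf Suc)
  qed
qed

text \<open>A form uniform in \<open>r\<close>: for \<open>r = 0\<close> both sides are
  false.\<close>

lemma waiting_time_eq_Suc_iff:
  "waiting_time l1 k1 l2 x r = enat (Suc k) \<longleftrightarrow> cnt x (Suc k) = r \<and> Suc (cnt x k) = r"
proof (cases r)
  case 0
  then show ?thesis by (simp add: waiting_time_0 zero_enat_def)
next
  case (Suc r')
  then show ?thesis by (auto simp: waiting_time_Suc_eq_iff cnt_Suc)
qed

text \<open>The count starts at 0, climbs in unit steps and never hits \<open>r\<close>, so it can
  never pass \<open>r\<close>.\<close>

lemma waiting_time_infinite:
  assumes "waiting_time l1 k1 l2 x r = \<infinity>"
  shows "cnt x n < r"
proof (induction n)
  have never: "cnt x n \<noteq> r" for n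
  proof
    assume "cnt x n = r"
    then have "waiting_time l1 k1 l2 x r \<le> enat n"
      unfolding waiting_time_def by (intro Inf_lower) auto
    with assms show False by simp
  qed
  {
    case 0
    show ?case using never[of 0] by simp
  next
    case (Suc n)
    then show ?case using never[of "Suc n"] by (simp add: cnt_Suc of_bool_def split: if_splits)
  }
qed

section \<open>Completions described by final blocks of fixed length\<close>

lemma cnt_zeros:
  assumes "n \<le> m" "\<And>i. n < i \<Longrightarrow> i \<le> m \<Longrightarrow> x i = 0"
  shows "cnt x m = cnt x n"
proof (rule cnt_constI[OF assms(1)])
  fix i assume "n < i" "i \<le> m"
  then show "\<not> completes x i"
    using assms(2)[of i] completes_ones[of x i i] l2_pos by auto
qed

text \<open>A completion needs \<open>l2\<close> ones just before it. Strictly before the end of the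
  run, the last \<open>l2\<close> positions still include the current zero or the zero at
  \<open>n + i\<close>.\<close>

lemma cnt_run_then_ones:
  assumes "run_then_ones x n i" "0 < i"
  shows "cnt x (n + i + l2 - 1) = cnt x n"
proof (rule cnt_constI)
  fix k assume k: "n < k" "k \<le> n + i + l2 - 1"
  show "\<not> completes x k"
  proof
    assume c: "completes x k"
    show False
    proof (cases "k \<le> n + i")
      case True
      then have "x k = 0" using assms k by (simp add: run_then_ones_def)
      then show False using completes_ones[OF c, of k] l2_pos by simp
    next
      case False
      then have "x (n + i) = 1" using completes_ones[OF c, of "n + i"] k l2_pos by simp
      then show False using assms l2_pos by (simp add: run_then_ones_def)
    qed
  qed
qed (use assms in simp)

text \<open>A maximal block has length between \<open>l1\<close> and \<open>k1\<close> iff the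
  \<open>l1\<close> positions before the ones are zeros but the \<open>Suc k1\<close> positions
  before them are not all zeros. Maximality thus becomes a difference of two events with fixed run
  lengths. The count before the run may replace the count at \<open>m - 1\<close>, because nothing
  completes in between.\<close>

lemma completes_iff:
  assumes bin: "\<And>i. 1 \<le> i \<Longrightarrow> x i = 0 \<or> x i = 1"
  shows "0 < m \<and> completes x m \<and> cnt x (m - 1) = r \<longleftrightarrow>
    (\<exists>n. m = n + l1 + l2 \<and> cnt x n = r \<and> run_then_ones x n l1) \<and>
    \<not> (\<exists>n. m = n + Suc k1 + l2 \<and> cnt x n = r \<and> run_then_ones x n (Suc k1))"
    (is "?L \<longleftrightarrow> ?R1 \<and> \<not> ?R2")
proof
  assume L: ?L
  then obtain s j where sj: "1 \<le> s" "l1 \<le> j" "j \<le> k1" "pattern_at l2 x s j" "m = s + j + l2 - 1"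
    unfolding completes_def by auto
  \<comment> \<open>The last position before the final \<open>l1\<close> zeros of the block.\<close>
  define n where "n = s + j - l1 - 1"
  have n: "s + j = n + l1 + 1" using sj by (simp add: n_def)
  have m: "m = n + l1 + l2" using sj n by simp
  have run: "run_then_ones x n l1"
    unfolding run_then_ones_def
  proof
    fix k assume k: "k \<in> {n<..n + (l1 + l2)}"
    then have "s \<le> k" "k < s + j + l2" using n sj by auto
    then show "x k = (if k \<le> n + l1 then 0 else 1)"
      using sj(4) n by (auto simp: pattern_at_def)
  qed
  have ?R1
    using L m run cnt_run_then_ones[OF run] l1_pos by auto
  moreover have "\<not> ?R2"
  proof
    assume ?R2
    then obtain n' where n': "m = n' + Suc k1 + l2" "run_then_ones x n' (Suc k1)" by blast
    \<comment> \<open>Since \<open>j \<le> k1\<close>, a run of \<open>Suc k1\<close> zeros ending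
      at the same place reaches back over position \<open>s - 1\<close>, where there must be a
      1.\<close>
    then have "n' < s - 1" "s - 1 \<le> n' + Suc k1"
      using sj m l2_pos by linarith+
    then have "x (s - 1) = 0" "s \<noteq> 1"
      using n'(2) by (auto simp: run_then_ones_def)
    then show False using sj(4) by (simp add: pattern_at_def)
  qed
  ultimately show "?R1 \<and> \<not> ?R2" by simp
next
  assume R: "?R1 \<and> \<not> ?R2"
  then obtain n where n: "m = n + l1 + l2" "cnt x n = r" and run: "run_then_ones x n l1" by blast
  \<comment> \<open>The least \<open>s\<close> satisfying \<open>P\<close> is where the maximal zero
    block starts. Its left neighbour, if any, is nonzero, hence 1 by \<open>bin\<close>.\<close>
  define P where "P s \<longleftrightarrow> 1 \<le> s \<and> (\<forall>i\<in>{s..n + l1}. x i = 0)" for s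
  define s where "s = (LEAST s. P s)"
  have "P (Suc n)" using run by (auto simp: P_def run_then_ones_def)
  then have Ps: "P s" and s_le: "s \<le> Suc n"
    unfolding s_def by (auto intro: LeastI Least_le)
  define j where "j = n + l1 + 1 - s"
  have start: "s = 1 \<or> x (s - 1) = 1"
  proof (rule ccontr)
    assume neg: "\<not> (s = 1 \<or> x (s - 1) = 1)"
    then have "1 \<le> s - 1" "x (s - 1) = 0" using bin[of "s - 1"] Ps by (auto simp: P_def)
    then have "P (s - 1)" using Ps unfolding P_def
      by (metis One_nat_def Suc_pred atLeastAtMost_iff le_antisym not_less_eq_eq not_less_zero linorder_not_less less_eq_Suc_le)
    then have "s \<le> s - 1" unfolding s_def by (rule Least_le)
    then show False using Ps by (auto simp: P_def)
  qed
  have "pattern_at l2 x s j"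
    using start Ps run s_le unfolding pattern_at_def P_def j_def run_then_ones_def by auto
  moreover have "j \<le> k1"
  proof (rule ccontr)
    assume "\<not> j \<le> k1"
    then have j: "Suc k1 \<le> j" by simp
    \<comment> \<open>The last position before the final \<open>Suc k1\<close> zeros. A block that
      is too long covers everything from \<open>n' + 1\<close> to \<open>n\<close>, so the counts at
      \<open>n'\<close> and \<open>n\<close> agree and the excluded event occurs.\<close>
    define n' where "n' = n + l1 - Suc k1"
    have n': "n + l1 = n' + Suc k1" "s \<le> Suc n'" using j Ps by (auto simp: n'_def j_def P_def)
    have "cnt x n = cnt x n'"
      using n' Ps l1_le by (intro cnt_zeros) (auto simp: P_def)
    moreover have "run_then_ones x n' (Suc k1)"
      using run n' Ps unfolding run_then_ones_def P_def by auto
    ultimately have ?R2 using n n' by (metis add.assoc)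
    then show False using R by blast
  qed
  moreover have "l1 \<le> j" "s + j + l2 - 1 = m" "1 \<le> s"
    using s_le n Ps by (auto simp: j_def P_def)
  ultimately have "completes x m" unfolding completes_def
    using \<open>j \<le> k1\<close> by (metis atLeastAtMost_iff)
  then show ?L using n cnt_run_then_ones[OF run] l1_pos by auto
qed

text \<open>Dropping the first \<open>Suc k1 - l1\<close> zeros keeps a run of \<open>l1\<close>
  zeros and does not change the count. Hence the event for \<open>Suc k1\<close> lies inside the
  event for \<open>l1\<close>.\<close>

lemma run_then_ones_mono:
  assumes "run_then_ones x n (Suc k1)"
  shows "run_then_ones x (n + (Suc k1 - l1)) l1" "cnt x (n + (Suc k1 - l1)) = cnt x n"
proof -
  show "run_then_ones x (n + (Suc k1 - l1)) l1"
    using assms l1_le by (auto simp: run_then_ones_def)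
  show "cnt x (n + (Suc k1 - l1)) = cnt x n"
    using assms l1_le by (intro cnt_zeros) (auto simp: run_then_ones_def)
qed

text \<open>The leading 1 makes the zero block maximal with length exactly \<open>l1\<close>, so an
  occurrence is certain, whatever the earlier trials are.\<close>

lemma cnt_one_run_then_ones:
  assumes "x (Suc n) = 1" "run_then_ones x (Suc n) l1"
  shows "cnt x n < cnt x (Suc n + l1 + l2)"
proof -
  have "pattern_at l2 x (n + 2) l1"
    using assms by (auto simp: pattern_at_def run_then_ones_def)
  then have "completes x (Suc n + l1 + l2)"
    unfolding completes_def using l1_le by (intro exI[of _ "n + 2"]) auto
  moreover have "Suc n + l1 + l2 = Suc (n + l1 + l2)" by simp
  ultimately have "cnt x (Suc n + l1 + l2) = Suc (cnt x (n + l1 + l2))"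
    by (simp only: cnt_Suc of_bool_eq)
  then show ?thesis
    using monoD[OF mono_cnt, of n "n + l1 + l2" x] by simp
qed

lemma cnt_restrict:
  assumes "\<And>i. 1 \<le> i \<Longrightarrow> i \<le> n \<Longrightarrow> x i = y i"
  shows "cnt x n = cnt y n"
proof -
  have "pattern_at l2 x s j \<longleftrightarrow> pattern_at l2 y s j" if "1 \<le> s" "s + j + l2 - 1 \<le> n" for s j
    using that assms l2_pos unfolding pattern_at_def
    by (intro conj_cong disj_cong ball_cong) auto
  then show ?thesis
    unfolding pattern_count_def by (intro arg_cong[where f = card]) (auto; blast)
qed

end

section \<open>Series and expectations\<close>

text \<open>The law of \<open>X\<close> is a density with respect to counting measure, which turns
  the integral into a series. Banach-valued \<open>\<phi>\<close> serves both real moments and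
  complex generating functions.\<close>

lemma (in prob_space) expectation_nat_valued:
  fixes X :: "'a \<Rightarrow> nat" and \<phi> :: "nat \<Rightarrow> 'b::{banach, second_countable_topology}"
  assumes X: "random_variable (count_space UNIV) X"
    and summable: "summable (\<lambda>n. norm (prob {\<omega> \<in> space M. X \<omega> = n} *\<^sub>R \<phi> n))"
  shows "integrable M (\<lambda>\<omega>. \<phi> (X \<omega>))"
    and "expectation (\<lambda>\<omega>. \<phi> (X \<omega>)) = (\<Sum>n. prob {\<omega> \<in> space M. X \<omega> = n} *\<^sub>R \<phi> n)"
proof -
  let ?D = "distr M (count_space UNIV) X"
  let ?w = "\<lambda>n. prob {\<omega> \<in> space M. X \<omega> = n}"
  have D: "?D = density (count_space UNIV) (\<lambda>n. ennreal (?w n))"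
  proof (rule measure_eqI_countable[where A = UNIV])
    fix n
    have "X -` {n} \<inter> space M = {\<omega> \<in> space M. X \<omega> = n}" by auto
    then show "emeasure ?D {n} = emeasure (density (count_space UNIV) (\<lambda>n. ennreal (?w n))) {n}"
      using X by (simp add: emeasure_distr emeasure_density emeasure_eq_measure)
  qed auto
  have int: "integrable (count_space UNIV) (\<lambda>n. ?w n *\<^sub>R \<phi> n)"
    using summable by (simp add: integrable_count_space_nat_iff)
  then have "integrable ?D \<phi>"
    unfolding D by (subst integrable_density) auto
  then show "integrable M (\<lambda>\<omega>. \<phi> (X \<omega>))"
    by (subst (asm) integrable_distr_eq[OF X]) auto
  have "expectation (\<lambda>\<omega>. \<phi> (X \<omega>)) = integral\<^sup>L ?D \<phi>"
    by (rule integral_distr[OF X, symmetric]) simp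
  also have "\<dots> = integral\<^sup>L (count_space UNIV) (\<lambda>n. ?w n *\<^sub>R \<phi> n)"
    unfolding D by (subst integral_density) auto
  also have "\<dots> = (\<Sum>n. ?w n *\<^sub>R \<phi> n)"
    by (rule integral_count_space_nat[OF int])
  finally show "expectation (\<lambda>\<omega>. \<phi> (X \<omega>)) = (\<Sum>n. ?w n *\<^sub>R \<phi> n)" .
qed

text \<open>Moves a shift from the mass function to the test function. The first \<open>k\<close>
  terms of the new series vanish because \<open>f\<close> is zero at negative arguments.\<close>

lemma sums_shift_int:
  fixes f :: "int \<Rightarrow> real" and \<phi> :: "nat \<Rightarrow> 'b::real_normed_vector"
  assumes "\<And>m. m < 0 \<Longrightarrow> f m = 0" and "(\<lambda>n. f (int n) *\<^sub>R \<phi> (n + k)) sums s"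
  shows "(\<lambda>n. f (int n - int k) *\<^sub>R \<phi> n) sums s"
proof -
  have "(\<lambda>n. f (int (n + k) - int k) *\<^sub>R \<phi> (n + k)) sums s" using assms(2) by simp
  then show ?thesis by (subst (asm) sums_zero_iff_shift) (auto simp: assms(1))
qed

lemma summable_power_times_geometric:
  fixes x :: real
  assumes "0 < x" "x < 1"
  shows "summable (\<lambda>n. (real n + k) ^ j * x ^ n)"
proof (rule summable_comparison_test_bigo)
  show "summable (\<lambda>n. norm (sqrt x ^ n))"
    using assms by (simp add: summable_geometric)
  define c where "c = - ln x"
  have c: "0 < c" using assms by (simp add: c_def)
  \<comment> \<open>Exponentials with an explicit positive rate \<open>c\<close> bring the
    comparison into a form that \<open>real_asymp\<close> decides.\<close>
  have *: "x ^ n = exp (- c * real n)" "sqrt x ^ n = exp (- c / 2 * real n)" for n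
  proof -
    have "x = exp (- c)" using assms by (simp add: c_def)
    moreover have "sqrt x = exp (- c / 2)"
      using assms by (intro real_sqrt_unique) (auto simp: c_def power2_eq_square simp flip: exp_add)
    ultimately show "x ^ n = exp (- c * real n)" "sqrt x ^ n = exp (- c / 2 * real n)"
      by (simp_all flip: exp_of_nat_mult add: mult_ac)
  qed
  show "(\<lambda>n. (real n + k) ^ j * x ^ n) \<in> O(\<lambda>n. sqrt x ^ n)"
    unfolding * using c by real_asymp
qed


section \<open>Point masses of the waiting times\<close>

locale bernoulli_run_pattern = prob_space M + run_pattern l1 k1 l2
  for M :: "'a measure" and l1 k1 l2 :: nat +
  fixes \<zeta> :: "nat \<Rightarrow> 'a \<Rightarrow> nat" and p q :: real
  assumes indep: "indep_vars (\<lambda>_. count_space UNIV) \<zeta> {1..}"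
    and prob_one: "\<And>i. i \<ge> 1 \<Longrightarrow> prob {\<omega> \<in> space M. \<zeta> i \<omega> = 1} = p"
    and prob_zero: "\<And>i. i \<ge> 1 \<Longrightarrow> prob {\<omega> \<in> space M. \<zeta> i \<omega> = 0} = q"
    and p_pos: "0 < p" and p_less: "p < 1" and q_eq: "q = 1 - p"
begin

abbreviation trials :: "'a \<Rightarrow> nat \<Rightarrow> nat" where
  "trials \<omega> \<equiv> \<lambda>i. \<zeta> i \<omega>"

abbreviation wait :: "nat \<Rightarrow> 'a \<Rightarrow> enat" where
  "wait r \<omega> \<equiv> waiting_time l1 k1 l2 (trials \<omega>) r"

abbreviation wait_mass :: "nat \<Rightarrow> int \<Rightarrow> real" where
  "wait_mass r \<equiv> point_mass M (wait r)"

text \<open>The integer argument with value 0 below 0 matches \<open>point_mass\<close>, so shifted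
  identities need no side conditions.\<close>

definition count_mass :: "nat \<Rightarrow> int \<Rightarrow> real" where
  "count_mass r n = (if n < 0 then 0 else prob {\<omega> \<in> space M. cnt (trials \<omega>) (nat n) = r})"

section \<open>Events decided by finitely many trials\<close>

definition determined_by :: "nat \<Rightarrow> ((nat \<Rightarrow> nat) \<Rightarrow> 'b) \<Rightarrow> bool" where
  "determined_by n f \<longleftrightarrow> (\<forall>x y. (\<forall>i\<in>{1..n}. x i = y i) \<longrightarrow> f x = f y)"

lemma determined_by_cnt: "m \<le> n \<Longrightarrow> determined_by n (\<lambda>x. cnt x m)"
  unfolding determined_by_def by (auto intro!: cnt_restrict)

lemma random_variable_trial: "1 \<le> i \<Longrightarrow> random_variable (count_space UNIV) (\<zeta> i)"
  using indep by (auto simp: indep_vars_def)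

text \<open>A finite product of countable discrete spaces is discrete, so every function of finitely
  many trials is measurable.\<close>

lemma random_variable_determined:
  assumes "determined_by n f"
  shows "random_variable (count_space UNIV) (\<lambda>\<omega>. f (trials \<omega>))"
proof -
  let ?P = "PiM {1..n} (\<lambda>_. count_space UNIV :: nat measure)"
  have P: "?P = count_space (PiE {1..n} (\<lambda>_. UNIV))"
    by (intro count_space_PiM_finite) auto
  have "(\<lambda>\<omega>. restrict (trials \<omega>) {1..n}) \<in> measurable M ?P"
    by (intro measurable_restrict random_variable_trial) auto
  moreover have "f \<in> measurable ?P (count_space UNIV)"
    unfolding P by simp
  ultimately have "(\<lambda>\<omega>. f (restrict (trials \<omega>) {1..n})) \<in> measurable M (count_space UNIV)"
    by (rule measurable_compose)
  moreover have "f (restrict (trials \<omega>) {1..n}) = f (trials \<omega>)" for \<omega>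
    using assms unfolding determined_by_def by (metis restrict_apply)
  ultimately show ?thesis by simp
qed

lemma events_determined:
  assumes "determined_by n Q"
  shows "{\<omega> \<in> space M. Q (trials \<omega>)} \<in> events"
  using measurable_sets[OF random_variable_determined[OF assms], of "{True}"]
  by (simp add: vimage_def Int_def conj_commute)

text \<open>Independence is used twice: between the blocks \<open>{1..n}\<close> and
  \<open>{n<..n + b}\<close>, and then among the single trials of the second block.\<close>

lemma prob_past_and_future:
  assumes "determined_by n Q"
  shows "prob {\<omega> \<in> space M. Q (trials \<omega>) \<and> (\<forall>k\<in>{n<..n + b}. \<zeta> k \<omega> = v k)} =
    prob {\<omega> \<in> space M. Q (trials \<omega>)} * (\<Prod>k\<in>{n<..n + b}. prob {\<omega> \<in> space M. \<zeta> k \<omega> = v k})"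
proof (cases "b = 0")
  case False
  let ?A = "{1..n}" and ?B = "{n<..n + b}"
  let ?P = "\<lambda>A. PiM A (\<lambda>_. count_space UNIV :: nat measure)"
  let ?R = "\<lambda>A \<omega>. restrict (trials \<omega>) A"
  have P: "?P A = count_space (PiE A (\<lambda>_. UNIV))" if "finite A" for A :: "nat set"
    using that by (intro count_space_PiM_finite) auto
  let ?U = "{x \<in> PiE ?A (\<lambda>_. UNIV). Q x}" and ?V = "{x \<in> PiE ?B (\<lambda>_. UNIV). \<forall>k\<in>?B. x k = v k}"
  have Q: "Q (?R ?A \<omega>) = Q (trials \<omega>)" for \<omega>
    using assms unfolding determined_by_def by (metis restrict_apply)
  have "prob ((\<lambda>\<omega>. (?R ?A \<omega>, ?R ?B \<omega>)) -` (?U \<times> ?V) \<inter> space M) =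
    prob (?R ?A -` ?U \<inter> space M) * prob (?R ?B -` ?V \<inter> space M)"
    by (rule indep_varD[OF indep_var_restrict[OF indep]]) (auto simp: P)
  moreover have "(\<lambda>\<omega>. (?R ?A \<omega>, ?R ?B \<omega>)) -` (?U \<times> ?V) \<inter> space M =
      {\<omega> \<in> space M. Q (trials \<omega>) \<and> (\<forall>k\<in>?B. \<zeta> k \<omega> = v k)}"
    by (auto simp: Q simp del: One_nat_def)
  moreover have "?R ?A -` ?U \<inter> space M = {\<omega> \<in> space M. Q (trials \<omega>)}"
    by (auto simp: Q simp del: One_nat_def)
  \<comment> \<open>Nonemptiness of the second block matters here: an empty intersection would be
    \<open>UNIV\<close>, not \<open>space M\<close>.\<close>
  moreover have "?R ?B -` ?V \<inter> space M = (\<Inter>k\<in>?B. \<zeta> k -` {v k} \<inter> space M)"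
    using False by (auto simp: restrict_PiE_iff)
  moreover have "prob (\<Inter>k\<in>?B. \<zeta> k -` {v k} \<inter> space M) = (\<Prod>k\<in>?B. prob (\<zeta> k -` {v k} \<inter> space M))"
    using False by (intro indep_varsD[OF indep]) auto
  moreover have "\<zeta> k -` {v k} \<inter> space M = {\<omega> \<in> space M. \<zeta> k \<omega> = v k}" for k
    by auto
  ultimately show ?thesis by simp
qed simp

lemma prob_zeros_then_ones:
  "(\<Prod>k\<in>{n<..n + (i + j)}. prob {\<omega> \<in> space M. \<zeta> k \<omega> = (if k \<le> n + i then 0 else 1)}) = q ^ i * p ^ j"
proof -
  have "{n<..n + (i + j)} = {n<..n + i} \<union> {n + i<..n + i + j}" by auto
  then have "(\<Prod>k\<in>{n<..n + (i + j)}. prob {\<omega> \<in> space M. \<zeta> k \<omega> = (if k \<le> n + i then 0 else 1)}) =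
    (\<Prod>k\<in>{n<..n + i}. prob {\<omega> \<in> space M. \<zeta> k \<omega> = (if k \<le> n + i then 0 else 1)}) *
    (\<Prod>k\<in>{n + i<..n + i + j}. prob {\<omega> \<in> space M. \<zeta> k \<omega> = (if k \<le> n + i then 0 else 1)})"
    by (simp add: prod.union_disjoint)
  also have "\<dots> = (\<Prod>k\<in>{n<..n + i}. q) * (\<Prod>k\<in>{n + i<..n + i + j}. p)"
    by (intro arg_cong2[where f = "(*)"] prod.cong) (auto simp: prob_zero[simplified] prob_one[simplified])
  finally show ?thesis by simp
qed

text \<open>The trials may take any natural value, but 0 and 1 carry total mass
  \<open>q + p = 1\<close>. This supplies the hypothesis of \<open>completes_iff\<close> outside a
  null set.\<close>

lemma AE_trials_binary: "AE \<omega> in M. \<forall>i\<ge>1. \<zeta> i \<omega> = 0 \<or> \<zeta> i \<omega> = 1"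
proof -
  have "AE \<omega> in M. 1 \<le> i \<longrightarrow> \<zeta> i \<omega> = 0 \<or> \<zeta> i \<omega> = 1" for i
  proof (cases "1 \<le> i")
    case True
    have ev: "{\<omega> \<in> space M. \<zeta> i \<omega> = v} \<in> events" for v
      using measurable_sets[OF random_variable_trial[OF True], of "{v}"]
      by (simp add: vimage_def Int_def conj_commute)
    have "prob ({\<omega> \<in> space M. \<zeta> i \<omega> = 0} \<union> {\<omega> \<in> space M. \<zeta> i \<omega> = 1}) = q + p"
      using prob_zero[OF True] prob_one[OF True] ev by (subst finite_measure_Union) auto
    also have "{\<omega> \<in> space M. \<zeta> i \<omega> = 0} \<union> {\<omega> \<in> space M. \<zeta> i \<omega> = 1} =
        {\<omega> \<in> space M. \<zeta> i \<omega> = 0 \<or> \<zeta> i \<omega> = 1}"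
      by auto
    finally have "AE \<omega> in M. \<zeta> i \<omega> = 0 \<or> \<zeta> i \<omega> = 1"
      using q_eq AE_prob_1[of "{\<omega> \<in> space M. \<zeta> i \<omega> = 0 \<or> \<zeta> i \<omega> = 1}"] by simp
    then show ?thesis by auto
  qed simp
  then show ?thesis by (simp add: AE_all_countable)
qed

lemma events_wait:
  "{\<omega> \<in> space M. wait r \<omega> = enat m} \<in> events"
proof (cases r)
  case 0
  then show ?thesis by (simp add: waiting_time_0)
next
  case (Suc k)
  have "determined_by m (\<lambda>x. waiting_time l1 k1 l2 x (Suc k) = enat m)"
  proof (cases m)
    case 0
    then show ?thesis by (simp add: determined_by_def waiting_time_Suc_eq_iff)
  next
    case (Suc n)
    have "waiting_time l1 k1 l2 x (Suc k) = enat m \<longleftrightarrow> cnt x m = Suc k \<and> cnt x n = k" for x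
      by (auto simp: waiting_time_Suc_eq_iff Suc cnt_Suc)
    then show ?thesis
      using determined_by_cnt[of m m] determined_by_cnt[of n m] Suc
      unfolding determined_by_def by (metis le_add2 order_refl plus_1_eq_Suc)
  qed
  then show ?thesis unfolding Suc by (rule events_determined)
qed

section \<open>Point masses and their recurrence\<close>

lemma wait_mass_nonneg: "0 \<le> wait_mass r m"
  by (simp add: point_mass_def)

lemma wait_mass_neg: "m < 0 \<Longrightarrow> wait_mass r m = 0"
proof -
  assume "m < 0"
  then have "{\<omega> \<in> space M. \<exists>n. wait r \<omega> = enat n \<and> int n = m} = {}" by auto
  then show ?thesis by (simp only: point_mass_def measure_empty)
qed

lemma wait_mass_of_nat: "wait_mass r (int n) = prob {\<omega> \<in> space M. wait r \<omega> = enat n}"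
  by (simp add: point_mass_def)

lemma wait_mass_0: "wait_mass 0 m = (if m = 0 then 1 else 0)"
  by (auto simp: point_mass_def waiting_time_0 zero_enat_def prob_space)

lemma count_mass_nonneg: "0 \<le> count_mass r n"
  by (simp add: count_mass_def)

lemma determined_by_compose2:
  assumes "determined_by n f" "determined_by n g"
  shows "determined_by n (\<lambda>x. h (f x) (g x))"
  unfolding determined_by_def
proof (intro allI impI)
  fix x y :: "nat \<Rightarrow> nat" assume "\<forall>i\<in>{1..n}. x i = y i"
  then have "f x = f y" "g x = g y" using assms unfolding determined_by_def by blast+
  then show "h (f x) (g x) = h (f y) (g y)" by simp
qed

lemma determined_by_cnt_pred: "m \<le> n \<Longrightarrow> determined_by n (\<lambda>x. P (cnt x m))"
  using determined_by_compose2[OF determined_by_cnt determined_by_cnt, of m n m "\<lambda>u _. P u"] by simp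

lemma events_cnt: "{\<omega> \<in> space M. P (cnt (trials \<omega>) n)} \<in> events"
  by (rule events_determined[OF determined_by_cnt_pred[OF order_refl]])

lemma determined_by_run_then_ones:
  "determined_by (n + (i + l2)) (\<lambda>x. cnt x n = r \<and> run_then_ones x n i)"
  by (intro determined_by_compose2[where h = "(\<and>)"] determined_by_cnt_pred)
    (auto simp: determined_by_def run_then_ones_def)

lemma prob_run_then_ones:
  "prob {\<omega> \<in> space M. cnt (trials \<omega>) n = r \<and> run_then_ones (trials \<omega>) n i} =
    q ^ i * p ^ l2 * count_mass r (int n)"
  unfolding run_then_ones_def
  by (subst prob_past_and_future[OF determined_by_cnt_pred[OF order_refl], where v = "\<lambda>k. if k \<le> n + i then 0 else 1"])
    (simp add: prob_zeros_then_ones[simplified] count_mass_def)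

text \<open>By \<open>completes_iff\<close> the event is almost surely a difference of two nested
  events, and each of them factors into a past count and a fixed future run.\<close>

lemma wait_mass_Suc:
  "wait_mass (Suc r) m = q ^ l1 * p ^ l2 *
    (count_mass r (m - int (l1 + l2)) -
     q ^ (k1 - l1 + 1) * count_mass r (m - int (l1 + l2) - int (k1 - l1 + 1)))"
proof (cases "m < 0")
  case True
  then show ?thesis by (simp add: wait_mass_neg count_mass_def)
next
  case False
  then obtain n where m: "m = int n" using nonneg_int_cases by (metis linorder_not_less)
  \<comment> \<open>With \<open>k\<close> quantified, \<open>E i\<close> is empty when
    \<open>n < i + l2\<close>, in agreement with \<open>count_mass\<close> being 0 at negative
    arguments.\<close>
  define E where "E i = {\<omega> \<in> space M. \<exists>k. n = k + i + l2 \<and> cnt (trials \<omega>) k = r \<and>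
    run_then_ones (trials \<omega>) k i}" for i
  have E_eq: "E i = {\<omega> \<in> space M. cnt (trials \<omega>) k = r \<and> run_then_ones (trials \<omega>) k i}"
    if "n = k + i + l2" for i k
    using that by (auto simp: E_def)
  have E_empty: "E i = {}" if "n < i + l2" for i
    using that by (auto simp: E_def)
  have prob_E: "prob (E i) = q ^ i * p ^ l2 * count_mass r (m - int (i + l2))" for i
  proof (cases "n < i + l2")
    case True
    then show ?thesis by (simp add: E_empty count_mass_def m)
  next
    case False
    then have n: "n = (n - i - l2) + i + l2" by simp
    then have "m - int (i + l2) = int (n - i - l2)" by (simp add: m)
    then show ?thesis by (simp only: E_eq[OF n] prob_run_then_ones)
  qed
  have ev: "E i \<in> events" for i
  proof (cases "n < i + l2")
    case False
    then have "n = (n - i - l2) + i + l2" by simp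
    from E_eq[OF this] show ?thesis by (simp only: events_determined[OF determined_by_run_then_ones])
  qed (simp add: E_empty)
  have sub: "E (Suc k1) \<subseteq> E l1"
  proof
    fix \<omega> assume "\<omega> \<in> E (Suc k1)"
    then obtain k where k: "\<omega> \<in> space M" "n = k + Suc k1 + l2" "cnt (trials \<omega>) k = r"
      "run_then_ones (trials \<omega>) k (Suc k1)" by (auto simp: E_def)
    then show "\<omega> \<in> E l1"
      using run_then_ones_mono[OF k(4)] l1_le
      unfolding E_def by (intro CollectI conjI exI[of _ "k + (Suc k1 - l1)"]) auto
  qed
  have "wait_mass (Suc r) m = prob {\<omega> \<in> space M. wait (Suc r) \<omega> = enat n}"
    by (simp add: m wait_mass_of_nat)
  also have "\<dots> = prob (E l1 - E (Suc k1))"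
  proof (rule finite_measure_eq_AE)
    show "AE \<omega> in M. \<omega> \<in> {\<omega> \<in> space M. wait (Suc r) \<omega> = enat n} \<longleftrightarrow> \<omega> \<in> E l1 - E (Suc k1)"
      using AE_trials_binary
    proof (eventually_elim)
      case (elim \<omega>)
      then show ?case
        using completes_iff[of "trials \<omega>" n r] by (auto simp: E_def waiting_time_Suc_eq_iff)
    qed
  qed (use ev events_wait in auto)
  also have "\<dots> = prob (E l1) - prob (E (Suc k1))"
    by (rule finite_measure_Diff[OF ev ev sub])
  also have "\<dots> = q ^ l1 * p ^ l2 * count_mass r (m - int (l1 + l2)) -
      q ^ Suc k1 * p ^ l2 * count_mass r (m - int (Suc k1 + l2))"
    by (simp only: prob_E)
  also have "q ^ Suc k1 = q ^ l1 * q ^ (k1 - l1 + 1)"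
    using l1_le by (simp flip: power_add)
  also have "m - int (Suc k1 + l2) = m - int (l1 + l2) - int (k1 - l1 + 1)"
    using l1_le by simp
  finally show ?thesis by (simp add: algebra_simps)
qed

text \<open>The count enters the value \<open>r\<close> at the \<open>r\<close>-th occurrence and
  leaves it at the next one.\<close>

lemma count_mass_diff:
  "count_mass r n - count_mass r (n - 1) = wait_mass r n - wait_mass (Suc r) n"
proof -
  consider "n < 0" | "n = 0" | k where "n = int (Suc k)"
  proof (cases n rule: int_cases)
    case (nonneg k)
    then show ?thesis using that by (cases k) auto
  qed (use that in auto)
  then show ?thesis
  proof cases
    case 1
    then show ?thesis by (simp add: count_mass_def wait_mass_neg)
  next
    case 2
    have "wait r \<omega> = enat 0 \<longleftrightarrow> r = 0" for \<omega>
      by (cases r) (auto simp: waiting_time_0 zero_enat_def waiting_time_Suc_eq_iff)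
    then show ?thesis
      using 2 wait_mass_of_nat[of r 0] wait_mass_of_nat[of "Suc r" 0]
      by (auto simp: count_mass_def waiting_time_Suc_eq_iff prob_space)
  next
    case 3
    let ?C = "\<lambda>n. {\<omega> \<in> space M. cnt (trials \<omega>) n = r}"
    let ?W = "\<lambda>r. {\<omega> \<in> space M. wait r \<omega> = enat (Suc k)}"
    \<comment> \<open>Both sides are disjoint unions: count \<open>r\<close> now or just left,
      against count \<open>r\<close> before or just entered.\<close>
    have "?C (Suc k) \<union> ?W (Suc r) = ?C k \<union> ?W r"
      by (auto simp: waiting_time_eq_Suc_iff cnt_Suc of_bool_def split: if_splits)
    moreover have "?C (Suc k) \<inter> ?W (Suc r) = {}" "?C k \<inter> ?W r = {}"
      by (auto simp: waiting_time_eq_Suc_iff)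
    moreover have "?C n \<in> events" "?W r \<in> events" for n r
      by (rule events_cnt events_wait)+
    ultimately have "prob (?C (Suc k)) + prob (?W (Suc r)) = prob (?C k) + prob (?W r)"
      using finite_measure_Union[of "?C (Suc k)" "?W (Suc r)"] finite_measure_Union[of "?C k" "?W r"]
      by simp
    then show ?thesis
      using 3 wait_mass_of_nat[of r "Suc k"] wait_mass_of_nat[of "Suc r" "Suc k"]
      by (simp add: count_mass_def nat_add_distrib)
  qed
qed

text \<open>Differencing \<open>wait_mass_Suc\<close> in \<open>m\<close> leaves only differences of
  \<open>count_mass\<close>, which \<open>count_mass_diff\<close> eliminates. The identity over all
  integers can then be summed over all \<open>n\<close>.\<close>

lemma wait_mass_rec:
  fixes m :: int
  defines "l \<equiv> l1 + l2" and "m1 \<equiv> k1 - l1 + 1" and "a \<equiv> q ^ l1 * p ^ l2"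
  shows "wait_mass (Suc r) m = wait_mass (Suc r) (m - 1) +
    a * (wait_mass r (m - int l) - wait_mass (Suc r) (m - int l) -
      q ^ m1 * (wait_mass r (m - int l - int m1) - wait_mass (Suc r) (m - int l - int m1)))"
proof -
  have "wait_mass (Suc r) m - wait_mass (Suc r) (m - 1) =
    a * ((count_mass r (m - int l) - count_mass r (m - int l - 1)) -
      q ^ m1 * (count_mass r (m - int l - int m1) - count_mass r (m - int l - int m1 - 1)))"
    unfolding wait_mass_Suc[of r m] wait_mass_Suc[of r "m - 1"]
    by (simp add: l_def m1_def a_def algebra_simps)
  then show ?thesis unfolding count_mass_diff by simp
qed

lemma wait_mass_eq_0:
  "m < int ((l1 + l2) * r) \<Longrightarrow> wait_mass r m = 0"
proof (induction r arbitrary: m)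
  case 0
  then show ?case by (simp add: wait_mass_neg)
next
  case (Suc r)
  \<comment> \<open>Where \<open>wait_mass r\<close> vanishes, \<open>count_mass r\<close> cannot
    increase. It is nonnegative and 0 at -1, so it stays 0.\<close>
  have zero: "count_mass r n = 0" if n: "n < int ((l1 + l2) * r)" for n
  proof (cases "0 \<le> n")
    case True
    then show ?thesis using n
    proof (induction n rule: int_ge_induct)
      case base
      then show ?case using count_mass_diff[of r 0] Suc.IH[of 0] count_mass_nonneg[of r 0]
          wait_mass_nonneg[of "Suc r" 0] by (simp add: count_mass_def)
    next
      case (step n)
      then show ?case
        using count_mass_diff[of r "n + 1"] Suc.IH[of "n + 1"] count_mass_nonneg[of r "n + 1"]
          wait_mass_nonneg[of "Suc r" "n + 1"] by simp
    qed
  qed (simp add: count_mass_def)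
  have "m - int (l1 + l2) < int ((l1 + l2) * r)" using Suc.prems by simp
  then have "count_mass r (m - int (l1 + l2)) = 0"
    "count_mass r (m - int (l1 + l2) - int (k1 - l1 + 1)) = 0"
    by (auto intro!: zero)
  then show ?case by (simp only: wait_mass_Suc mult_zero_right diff_zero)
qed

section \<open>Geometric tails\<close>

text \<open>This is the probability that the \<open>r\<close>-th waiting time exceeds
  \<open>n\<close>.\<close>

definition tail :: "nat \<Rightarrow> nat \<Rightarrow> real" where
  "tail r n = prob {\<omega> \<in> space M. cnt (trials \<omega>) n < r}"

lemma tail_0: "tail 0 n = 0"
  by (simp add: tail_def)

text \<open>A block \<open>1 0\<dots>0 1\<dots>1\<close> forces an occurrence whatever precedes it.\<close>

lemma tail_step:
  defines "s \<equiv> p * (q ^ l1 * p ^ l2)"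
  shows "tail (Suc r) (n + Suc (l1 + l2)) \<le> (1 - s) * tail (Suc r) n + s * tail r n"
proof -
  let ?F = "{\<omega> \<in> space M. cnt (trials \<omega>) n = r \<and>
    (\<forall>k\<in>{n<..n + Suc (l1 + l2)}. \<zeta> k \<omega> = (if n + 1 < k \<and> k \<le> Suc n + l1 then 0 else 1))}"
  have range: "{n<..n + Suc (l1 + l2)} = insert (Suc n) {Suc n<..Suc n + (l1 + l2)}" by auto
  have prob_F: "prob ?F = prob {\<omega> \<in> space M. cnt (trials \<omega>) n = r} * s"
  proof -
    have "(\<Prod>k\<in>{n<..n + Suc (l1 + l2)}.
        prob {\<omega> \<in> space M. \<zeta> k \<omega> = (if n + 1 < k \<and> k \<le> Suc n + l1 then 0 else 1)}) =
      p * (\<Prod>k\<in>{Suc n<..Suc n + (l1 + l2)}.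
        prob {\<omega> \<in> space M. \<zeta> k \<omega> = (if k \<le> Suc n + l1 then 0 else 1)})"
      unfolding range using prob_one[of "Suc n"]
      by (subst prod.insert) (auto intro!: prod.cong)
    then show ?thesis
      by (subst prob_past_and_future[OF determined_by_cnt_pred[OF order_refl],
            where v = "\<lambda>k. if n + 1 < k \<and> k \<le> Suc n + l1 then 0 else 1"])
        (simp only: prob_zeros_then_ones s_def)
  qed
  have ev_F: "?F \<in> events"
  proof (rule events_determined[where n = "n + Suc (l1 + l2)"])
    show "determined_by (n + Suc (l1 + l2)) (\<lambda>x. cnt x n = r \<and>
      (\<forall>k\<in>{n<..n + Suc (l1 + l2)}. x k = (if n + 1 < k \<and> k \<le> Suc n + l1 then 0 else 1)))"
      by (intro determined_by_compose2[where h = "(\<and>)"] determined_by_cnt_pred)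
        (auto simp: determined_by_def)
  qed
  let ?T = "\<lambda>r n. {\<omega> \<in> space M. cnt (trials \<omega>) n < r}"
  have "?T (Suc r) (n + Suc (l1 + l2)) \<subseteq> ?T (Suc r) n - ?F"
  proof (intro subsetI DiffI)
    fix \<omega> assume \<omega>: "\<omega> \<in> ?T (Suc r) (n + Suc (l1 + l2))"
    then show "\<omega> \<in> ?T (Suc r) n"
      using monoD[OF mono_cnt, of n "n + Suc (l1 + l2)" "trials \<omega>"] by auto
    show "\<omega> \<notin> ?F"
    proof
      assume "\<omega> \<in> ?F"
      then have "\<zeta> (Suc n) \<omega> = 1" "run_then_ones (trials \<omega>) (Suc n) l1" "cnt (trials \<omega>) n = r"
        unfolding run_then_ones_def by auto
      then have "cnt (trials \<omega>) n < cnt (trials \<omega>) (Suc n + l1 + l2)" "cnt (trials \<omega>) n = r"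
        using cnt_one_run_then_ones[of "trials \<omega>" n] by blast+
      with \<omega> show False by (simp add: ac_simps)
    qed
  qed
  then have "tail (Suc r) (n + Suc (l1 + l2)) \<le> prob (?T (Suc r) n - ?F)"
    unfolding tail_def by (intro finite_measure_mono) (use ev_F events_cnt[of "\<lambda>c. c < Suc r" n] in auto)
  also have "\<dots> = tail (Suc r) n - prob ?F"
    unfolding tail_def by (intro finite_measure_Diff ev_F events_cnt) auto
  \<comment> \<open>Subtracting \<open>s\<close> times this difference leaves a convex combination
    of \<open>tail (Suc r) n\<close> and \<open>tail r n\<close>.\<close>
  also have "prob {\<omega> \<in> space M. cnt (trials \<omega>) n = r} = tail (Suc r) n - tail r n"
  proof -
    have "?T (Suc r) n = ?T r n \<union> {\<omega> \<in> space M. cnt (trials \<omega>) n = r}" by auto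
    moreover have "?T r n \<inter> {\<omega> \<in> space M. cnt (trials \<omega>) n = r} = {}" by auto
    moreover have "?T r n \<in> events" "{\<omega> \<in> space M. cnt (trials \<omega>) n = r} \<in> events"
      by (rule events_cnt)+
    ultimately show ?thesis
      unfolding tail_def by (simp only: finite_measure_Union)
  qed
  with prob_F have "prob ?F = (tail (Suc r) n - tail r n) * s" by simp
  finally show ?thesis by (simp add: algebra_simps)
qed

text \<open>Induction on \<open>r\<close>, then on \<open>n\<close> in steps of \<open>b\<close>.
  The factor \<open>2 ^ r\<close> halves the bound for the smaller index, so the convex combination
  in \<open>tail_step\<close> contracts by \<open>(1 - s) + s / 2 = 1 - s / 2\<close>.\<close>

lemma tail_geometric:
  obtains K \<theta> where "0 < K" "0 < \<theta>" "\<theta> < 1" "\<And>r n. tail r n \<le> K * 2 ^ r * \<theta> ^ n"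
proof -
  define s where "s = p * (q ^ l1 * p ^ l2)"
  define b where "b = Suc (l1 + l2)"
  have q: "0 < q" "q < 1" using q_eq p_pos p_less by auto
  have "0 < s" using p_pos q by (simp add: s_def)
  have "s < 1"
  proof -
    have "q ^ l1 * p ^ l2 \<le> 1"
      using q p_pos p_less by (intro mult_le_one power_le_one) auto
    then have "s \<le> p" using p_pos by (simp add: s_def)
    with p_less show ?thesis by simp
  qed
  \<comment> \<open>The root spreads the contraction over the \<open>b\<close> trials of one
    step.\<close>
  define \<theta> where "\<theta> = root b (1 - s / 2)"
  have "0 < b" by (simp add: b_def)
  then have \<theta>_b: "\<theta> ^ b = 1 - s / 2" using \<open>s < 1\<close> by (simp add: \<theta>_def)
  have \<theta>: "0 < \<theta>" "\<theta> < 1" using \<open>0 < s\<close> \<open>s < 1\<close> by (auto simp: \<theta>_def b_def)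
  \<comment> \<open>Chosen so that \<open>K * \<theta> ^ n \<ge> 1\<close> for \<open>n < b\<close>,
    where the trivial bound 1 is used.\<close>
  define K where "K = inverse (\<theta> ^ b)"
  have "0 < K" using \<theta> by (simp add: K_def)
  have "tail r n \<le> K * 2 ^ r * \<theta> ^ n" for r n
  proof (induction r arbitrary: n)
    case 0
    then show ?case using \<theta> \<open>0 < K\<close> by (simp add: tail_0)
  next
    case (Suc r)
    show ?case
    proof (induction n rule: less_induct)
      case (less n)
      show ?case
      proof (cases "n < b")
        case True
        have "tail (Suc r) n \<le> 1 * 1" by (simp add: tail_def)
        also have "\<dots> \<le> 2 ^ Suc r * (K * \<theta> ^ n)"
        proof (rule mult_mono)
          have "\<theta> ^ b \<le> \<theta> ^ n" using True \<theta> by (intro power_decreasing) auto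
          then show "1 \<le> K * \<theta> ^ n" using \<theta> by (simp add: K_def field_simps)
          show "1 \<le> (2::real) ^ Suc r" by (rule one_le_power) simp
        qed auto
        finally show ?thesis by (simp add: mult_ac)
      next
        case False
        define m where "m = n - b"
        have n: "n = m + b" "m < n" using False by (auto simp: m_def b_def)
        have "tail (Suc r) n \<le> (1 - s) * tail (Suc r) m + s * tail r m"
          using tail_step[of r m] by (simp add: n s_def b_def)
        also have "\<dots> \<le> (1 - s) * (K * 2 ^ Suc r * \<theta> ^ m) + s * (K * 2 ^ r * \<theta> ^ m)"
          using less n Suc.IH \<open>0 < s\<close> \<open>s < 1\<close> by (intro add_mono mult_left_mono) auto
        also have "\<dots> = K * 2 ^ Suc r * (\<theta> ^ m * (1 - s / 2))" by (simp add: algebra_simps)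
        also have "\<dots> = K * 2 ^ Suc r * \<theta> ^ n" by (simp add: n power_add \<theta>_b)
        finally show ?thesis .
      qed
    qed
  qed
  then show ?thesis using that \<open>0 < K\<close> \<theta> by blast
qed

lemma wait_mass_geometric:
  obtains K \<theta> where "0 < \<theta>" "\<theta> < 1" "\<And>n. wait_mass r (int n) \<le> K * \<theta> ^ n"
proof -
  obtain K \<theta> where K: "0 < K" "0 < \<theta>" "\<theta> < 1" "\<And>r n. tail r n \<le> K * 2 ^ r * \<theta> ^ n"
    using tail_geometric by blast
  \<comment> \<open>A wait equal to \<open>Suc k\<close> forces fewer than \<open>r\<close>
    occurrences by \<open>k\<close>. The division by \<open>\<theta>\<close> pays for this shift by
    one, and the added 1 covers \<open>n = 0\<close>.\<close>
  have "wait_mass r (int n) \<le> (K * 2 ^ r / \<theta> + 1) * \<theta> ^ n" for n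
  proof (cases n)
    case 0
    have "wait_mass r 0 \<le> 1" by (simp add: point_mass_def)
    moreover have "0 \<le> K * 2 ^ r / \<theta>" using K by simp
    ultimately show ?thesis using 0 by simp
  next
    case (Suc k)
    have "wait_mass r (int (Suc k)) \<le> tail r k"
      unfolding wait_mass_of_nat tail_def
      by (intro finite_measure_mono events_cnt) (auto simp: waiting_time_eq_Suc_iff)
    also have "\<dots> \<le> K * 2 ^ r * \<theta> ^ k" by (rule K)
    also have "\<dots> = K * 2 ^ r / \<theta> * \<theta> ^ n" using K by (simp add: Suc)
    also have "\<dots> \<le> (K * 2 ^ r / \<theta> + 1) * \<theta> ^ n" using K by (intro mult_right_mono) auto
    finally show ?thesis by (simp add: Suc)
  qed
  then show ?thesis using that K by blast
qed

text \<open>An infinite wait keeps the count below \<open>r\<close> forever, an event bounded by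
  every term of a null sequence.\<close>

lemma AE_wait_finite: "AE \<omega> in M. wait r \<omega> \<noteq> \<infinity>"
proof -
  obtain K \<theta> where K: "0 < K" "0 < \<theta>" "\<theta> < 1" "\<And>r n. tail r n \<le> K * 2 ^ r * \<theta> ^ n"
    using tail_geometric by blast
  let ?I = "\<Inter>n. {\<omega> \<in> space M. cnt (trials \<omega>) n < r}"
  have ev: "?I \<in> events" using events_cnt by auto
  have "prob ?I \<le> K * 2 ^ r * \<theta> ^ n" for n
    using K(4)[of r n] finite_measure_mono[of ?I "{\<omega> \<in> space M. cnt (trials \<omega>) n < r}"]
      events_cnt[of "\<lambda>c. c < r" n] unfolding tail_def by fastforce
  moreover have "(\<lambda>n. K * 2 ^ r * \<theta> ^ n) \<longlonglongrightarrow> K * 2 ^ r * 0"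
    using K by (intro tendsto_mult tendsto_const LIMSEQ_power_zero) auto
  ultimately have "prob ?I \<le> 0"
    by (intro LIMSEQ_le_const[of _ 0]) auto
  then have "?I \<in> null_sets M"
    using ev by (simp add: null_setsI emeasure_eq_measure measure_le_0_iff)
  then have "AE \<omega> in M. \<omega> \<notin> ?I" by (rule AE_not_in)
  then show ?thesis using AE_space by eventually_elim (use waiting_time_infinite in blast)
qed

section \<open>Moments and generating functions\<close>

lemma random_variable_wait: "random_variable (count_space UNIV) (wait r)"
proof -
  have "wait r -` {e} \<inter> space M \<in> events" for e
  proof (cases e)
    case (enat n)
    have "wait r -` {enat n} \<inter> space M = {\<omega> \<in> space M. wait r \<omega> = enat n}" by auto
    then show ?thesis using events_wait enat by simp
  next
    case infinity
    have "wait r -` {\<infinity>} \<inter> space M = space M - (\<Union>n. {\<omega> \<in> space M. wait r \<omega> = enat n})" by auto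
    moreover have "(\<Union>n. {\<omega> \<in> space M. wait r \<omega> = enat n}) \<in> events" using events_wait by auto
    ultimately show ?thesis using infinity by auto
  qed
  then show ?thesis
    by (subst measurable_count_space_eq2_countable) auto
qed

lemma random_variable_the_enat_wait:
  "random_variable (count_space UNIV) (\<lambda>\<omega>. the_enat (wait r \<omega>))"
  by (rule measurable_compose[OF random_variable_wait]) simp

text \<open>The unspecified value \<open>the_enat \<infinity>\<close> matters only on a null
  set.\<close>

lemma prob_the_enat_wait:
  "prob {\<omega> \<in> space M. the_enat (wait r \<omega>) = n} = wait_mass r (int n)"
  unfolding wait_mass_of_nat
proof (rule finite_measure_eq_AE)
  show "{\<omega> \<in> space M. the_enat (wait r \<omega>) = n} \<in> events"
    using measurable_sets[OF random_variable_the_enat_wait, of "{n}" r]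
    by (simp add: vimage_def Int_def conj_commute)
  show "AE \<omega> in M. \<omega> \<in> {\<omega> \<in> space M. the_enat (wait r \<omega>) = n} \<longleftrightarrow>
      \<omega> \<in> {\<omega> \<in> space M. wait r \<omega> = enat n}"
    using AE_wait_finite[of r] by eventually_elim auto
qed (rule events_wait)

text \<open>Geometric decay beats polynomial growth. The bound covers \<open>n ^ j\<close> with
  \<open>c = 0\<close> and \<open>t ^ n\<close> with exponent 0, and its form survives a shift of
  the argument.\<close>

lemma summable_wait_mass:
  fixes \<phi> :: "nat \<Rightarrow> 'b::real_normed_vector"
  assumes "\<And>n. norm (\<phi> n) \<le> (real n + c) ^ j"
  shows "summable (\<lambda>n. norm (wait_mass r (int n) *\<^sub>R \<phi> n))"
proof -
  obtain K \<theta> where K: "0 < \<theta>" "\<theta> < 1" "\<And>n. wait_mass r (int n) \<le> K * \<theta> ^ n"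
    using wait_mass_geometric by metis
  show ?thesis
  proof (rule summable_comparison_test')
    show "summable (\<lambda>n. K * ((real n + c) ^ j * \<theta> ^ n))"
      using K by (intro summable_mult summable_power_times_geometric)
    fix n
    have "wait_mass r (int n) * norm (\<phi> n) \<le> (K * \<theta> ^ n) * (real n + c) ^ j"
      using K(3)[of n] wait_mass_nonneg[of r "int n"] assms[of n]
      by (intro mult_mono) (auto intro: order_trans)
    then show "norm (norm (wait_mass r (int n) *\<^sub>R \<phi> n)) \<le> K * ((real n + c) ^ j * \<theta> ^ n)"
      by (simp add: mult_ac wait_mass_nonneg)
  qed
qed

lemma expectation_wait:
  fixes \<phi> :: "nat \<Rightarrow> 'b::{banach, second_countable_topology}"
  assumes "\<And>n. norm (\<phi> n) \<le> (real n + c) ^ j"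
  shows "integrable M (\<lambda>\<omega>. \<phi> (the_enat (wait r \<omega>)))"
    and "expectation (\<lambda>\<omega>. \<phi> (the_enat (wait r \<omega>))) = (\<Sum>n. wait_mass r (int n) *\<^sub>R \<phi> n)"
  using expectation_nat_valued[OF random_variable_the_enat_wait, of r \<phi>]
    summable_wait_mass[of \<phi> c j r] assms
  by (simp_all add: prob_the_enat_wait)

text \<open>The recurrence is multiplied by \<open>\<phi> n\<close> and summed; \<open>S r k\<close>
  records an argument shifted by \<open>k\<close>. Powers of \<open>n\<close> and of
  \<open>t\<close> are the two instances used below.\<close>

lemma suminf_wait_mass_rec:
  fixes \<phi> :: "nat \<Rightarrow> 'b::banach"
  defines "S \<equiv> \<lambda>r k. \<Sum>n. wait_mass r (int n) *\<^sub>R \<phi> (n + k)"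
    and "l \<equiv> l1 + l2" and "m1 \<equiv> k1 - l1 + 1" and "a \<equiv> q ^ l1 * p ^ l2"
  assumes bound: "\<And>n. norm (\<phi> n) \<le> (real n + c) ^ j"
  shows "S (Suc r) 0 = S (Suc r) 1 +
    a *\<^sub>R (S r l - S (Suc r) l - q ^ m1 *\<^sub>R (S r (l + m1) - S (Suc r) (l + m1)))"
proof -
  have "norm (\<phi> (n + k)) \<le> (real n + (real k + c)) ^ j" for n k
    using bound[of "n + k"] by (simp add: add_ac)
  then have "(\<lambda>n. wait_mass r (int n) *\<^sub>R \<phi> (n + k)) sums S r k" for r k
    unfolding S_def
    by (intro summable_sums summable_norm_cancel[OF summable_wait_mass]) auto
  then have sums: "(\<lambda>n. wait_mass r (int n - int k) *\<^sub>R \<phi> n) sums S r k" for r k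
    by (intro sums_shift_int wait_mass_neg)
  let ?T = "\<lambda>r k n. wait_mass r (int n - int k) *\<^sub>R \<phi> n"
  have "(\<lambda>n. ?T (Suc r) 1 n + a *\<^sub>R (?T r l n - ?T (Suc r) l n -
      q ^ m1 *\<^sub>R (?T r (l + m1) n - ?T (Suc r) (l + m1) n))) sums
    (S (Suc r) 1 + a *\<^sub>R (S r l - S (Suc r) l - q ^ m1 *\<^sub>R (S r (l + m1) - S (Suc r) (l + m1))))"
    by (intro sums_add sums_diff sums_scaleR_right sums)
  moreover have "?T (Suc r) 1 n + a *\<^sub>R (?T r l n - ?T (Suc r) l n -
      q ^ m1 *\<^sub>R (?T r (l + m1) n - ?T (Suc r) (l + m1) n)) = ?T (Suc r) 0 n" for n
  proof -
    \<comment> \<open>Collects the scalars into one coefficient, which is the right-hand side of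
      \<open>wait_mass_rec\<close>.\<close>
    have lin: "x1 *\<^sub>R f + a *\<^sub>R (y *\<^sub>R f - z *\<^sub>R f - q ^ m1 *\<^sub>R (u *\<^sub>R f - v *\<^sub>R f)) =
      (x1 + a * (y - z - q ^ m1 * (u - v))) *\<^sub>R f" for x1 y z u v and f :: 'b
      by (simp add: algebra_simps)
    show ?thesis
      unfolding lin using wait_mass_rec[of r "int n"]
      unfolding l_def[symmetric] m1_def[symmetric] a_def[symmetric]
      by (simp add: diff_diff_eq)
  qed
  ultimately have "(\<lambda>n. ?T (Suc r) 0 n) sums
    (S (Suc r) 1 + a *\<^sub>R (S r l - S (Suc r) l - q ^ m1 *\<^sub>R (S r (l + m1) - S (Suc r) (l + m1))))"
    by (simp only:)
  with sums[of "Suc r" 0] show ?thesis by (rule sums_unique2)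
qed

definition moment :: "nat \<Rightarrow> nat \<Rightarrow> real" where
  "moment r j = (\<Sum>n. wait_mass r (int n) * real n ^ j)"

text \<open>Identifies the extended moment with a convergent real series, so all moments are
  finite.\<close>

lemma raw_moment_wait: "raw_moment M (wait r) j = ennreal (moment r j)"
proof -
  let ?X = "\<lambda>\<omega>. the_enat (wait r \<omega>)"
  have int: "integrable M (\<lambda>\<omega>. real (?X \<omega>) ^ j)"
    and E: "expectation (\<lambda>\<omega>. real (?X \<omega>) ^ j) = moment r j"
    using expectation_wait[of "\<lambda>n. real n ^ j" 0 j r] by (simp_all add: moment_def)
  have "raw_moment M (wait r) j = (\<integral>\<^sup>+\<omega>. ennreal (real (?X \<omega>) ^ j) \<partial>M)"
    unfolding raw_moment_def
  proof (rule nn_integral_cong_AE)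
    show "AE \<omega> in M. ennreal_of_enat (wait r \<omega>) ^ j = ennreal (real (?X \<omega>) ^ j)"
      using AE_wait_finite[of r]
      by eventually_elim (auto simp: ennreal_of_nat_eq_real_of_nat ennreal_power)
  qed
  also have "\<dots> = ennreal (moment r j)"
    using nn_integral_eq_integral[OF int] E by simp
  finally show ?thesis .
qed

lemma sums_moment: "(\<lambda>n. wait_mass r (int n) * real n ^ j) sums moment r j"
proof -
  have "summable (\<lambda>n. norm (wait_mass r (int n) *\<^sub>R real n ^ j))"
    by (rule summable_wait_mass[where c = 0 and j = j]) simp
  then show ?thesis
    unfolding moment_def real_scaleR_def by (rule summable_sums[OF summable_norm_cancel])
qed

lemma moment_nonneg: "0 \<le> moment r j"
  by (rule sums_le[OF _ sums_zero sums_moment]) (simp add: wait_mass_nonneg)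

lemma suminf_wait_mass_shifted_power:
  "(\<Sum>n. wait_mass r (int n) * real (n + k) ^ j) =
    (\<Sum>i\<le>j. real (j choose i) * real k ^ (j - i) * moment r i)"
proof -
  have "(\<lambda>n. \<Sum>i\<le>j. real (j choose i) * real k ^ (j - i) * (wait_mass r (int n) * real n ^ i)) sums
    (\<Sum>i\<le>j. real (j choose i) * real k ^ (j - i) * moment r i)"
    by (intro sums_sum sums_mult sums_moment)
  moreover have "(\<Sum>i\<le>j. real (j choose i) * real k ^ (j - i) * (wait_mass r (int n) * real n ^ i)) =
    wait_mass r (int n) * real (n + k) ^ j" for n
    by (simp add: binomial_ring sum_distrib_left mult_ac)
  ultimately show ?thesis by (simp add: sums_iff)
qed

text \<open>The case \<open>\<phi> n = n ^ j\<close>: the shifts 1, \<open>l\<close> and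
  \<open>l + m1\<close> expand by the binomial theorem, and the shift 1 contributes the plain
  moments of index \<open>Suc r\<close>.\<close>

lemma moment_rec:
  defines "l \<equiv> l1 + l2" and "m1 \<equiv> k1 - l1 + 1" and "a \<equiv> q ^ l1 * p ^ l2"
  shows "moment (Suc r) j = (\<Sum>k=0..j. real (j choose k) * (moment (Suc r) k +
    a * (real l ^ (j - k) - q ^ m1 * real (l + m1) ^ (j - k)) * (moment r k - moment (Suc r) k)))"
proof -
  let ?S = "\<lambda>r k. \<Sum>i\<le>j. real (j choose i) * real k ^ (j - i) * moment r i"
  have "norm (real n ^ j) \<le> (real n + 0) ^ j" for n by simp
  from suminf_wait_mass_rec[of "\<lambda>n. real n ^ j", OF this, of r]
  have "moment (Suc r) j = ?S (Suc r) 1 +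
    a * (?S r l - ?S (Suc r) l - q ^ m1 * (?S r (l + m1) - ?S (Suc r) (l + m1)))"
    unfolding real_scaleR_def add_0_right l_def[symmetric] m1_def[symmetric] a_def[symmetric]
      suminf_wait_mass_shifted_power moment_def[symmetric] .
  also have "\<dots> = (\<Sum>k\<le>j. real (j choose k) * (moment (Suc r) k +
    a * (real l ^ (j - k) - q ^ m1 * real (l + m1) ^ (j - k)) * (moment r k - moment (Suc r) k)))"
    by (simp add: sum_distrib_left sum.distrib sum_subtractf ring_distribs mult_ac)
  finally show ?thesis by (simp add: atMost_atLeast0)
qed

lemma moment_0: "moment 0 i = (if i = 0 then 1 else 0)"
proof -
  have "(\<lambda>n. wait_mass 0 (int n) * real n ^ i) sums (\<Sum>n\<in>{0}. wait_mass 0 (int n) * real n ^ i)"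
    by (intro sums_finite) (auto simp: wait_mass_0)
  then show ?thesis by (simp add: moment_def sums_iff wait_mass_0 power_0_left)
qed

section \<open>The generating function\<close>

lemma prob_gen_fun_wait:
  assumes "cmod t \<le> 1"
  shows "prob_gen_fun M (wait r) t = (\<Sum>n. wait_mass r (int n) *\<^sub>R t ^ n)"
proof -
  have bound: "norm (t ^ n) \<le> (real n + 1) ^ 0" for n
    using assms by (simp add: norm_power power_le_one)
  have "prob_gen_fun M (wait r) t = expectation (\<lambda>\<omega>. t ^ the_enat (wait r \<omega>))"
    unfolding prob_gen_fun_def
  proof (rule Bochner_Integration.integral_cong_AE)
    let ?X = "\<lambda>\<omega>. the_enat (wait r \<omega>)"
    show "(\<lambda>\<omega>. t ^ ?X \<omega>) \<in> borel_measurable M"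
      using expectation_wait(1)[of "\<lambda>n. t ^ n", OF bound] by auto
    show "AE \<omega> in M. (case wait r \<omega> of enat n \<Rightarrow> t ^ n | \<infinity> \<Rightarrow> 0) = t ^ ?X \<omega>"
      using AE_wait_finite[of r] by eventually_elim auto
    show "(\<lambda>\<omega>. case wait r \<omega> of enat n \<Rightarrow> t ^ n | \<infinity> \<Rightarrow> 0) \<in> borel_measurable M"
      by (rule measurable_compose[OF random_variable_wait]) simp
  qed
  then show ?thesis using expectation_wait(2)[of "\<lambda>n. t ^ n", OF bound] by simp
qed

text \<open>The case \<open>\<phi> n = t ^ n\<close>, where a shift by \<open>k\<close> is
  multiplication by \<open>t ^ k\<close>. Division is postponed until the denominator is known to be
  nonzero.\<close>

lemma prob_gen_fun_rec:
  fixes t :: complex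
  defines "A \<equiv> of_real (q ^ l1 * p ^ l2) * t ^ (l1 + l2) * (1 - (of_real q * t) ^ (k1 - l1 + 1))"
  assumes t: "cmod t \<le> 1"
  shows "prob_gen_fun M (wait (Suc r)) t * (1 - t + A) = A * prob_gen_fun M (wait r) t"
proof -
  define l m1 a where "l = l1 + l2" and "m1 = k1 - l1 + 1" and "a = q ^ l1 * p ^ l2"
  note folds = l_def[symmetric] m1_def[symmetric] a_def[symmetric]
  let ?P = "\<lambda>r. prob_gen_fun M (wait r) t"
  have bound: "norm (t ^ n) \<le> (real n + 1) ^ 0" for n
    using t by (simp add: norm_power power_le_one)
  have shift: "(\<Sum>n. wait_mass r (int n) *\<^sub>R t ^ (n + k)) = t ^ k * ?P r" for r k
  proof -
    have "(\<Sum>n. wait_mass r (int n) *\<^sub>R t ^ (n + k)) = (\<Sum>n. t ^ k * (wait_mass r (int n) *\<^sub>R t ^ n))"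
      by (simp add: power_add mult.commute)
    also have "\<dots> = t ^ k * ?P r"
      unfolding prob_gen_fun_wait[OF t]
      by (intro suminf_mult summable_norm_cancel[OF summable_wait_mass[OF bound]])
    finally show ?thesis .
  qed
  have eq: "?P (Suc r) = t * ?P (Suc r) + a *\<^sub>R (t ^ l * ?P r - t ^ l * ?P (Suc r) -
      q ^ m1 *\<^sub>R (t ^ (l + m1) * ?P r - t ^ (l + m1) * ?P (Suc r)))"
    using suminf_wait_mass_rec[of "\<lambda>n. t ^ n", OF bound, of r]
    unfolding folds shift by simp
  have A: "A = of_real a * t ^ l * (1 - of_real q ^ m1 * t ^ m1)"
    unfolding A_def folds by (simp only: power_mult_distrib)
  have "x * (1 - t + A) - A * y = x - (t * x + a *\<^sub>R (t ^ l * y - t ^ l * x -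
      q ^ m1 *\<^sub>R (t ^ (l + m1) * y - t ^ (l + m1) * x)))" for x y
    by (simp add: A scaleR_conv_of_real power_add algebra_simps)
  from this[of "?P (Suc r)" "?P r"] show ?thesis
    unfolding eq[symmetric] by simp
qed

lemma prob_gen_fun_wait_0: "cmod t \<le> 1 \<Longrightarrow> prob_gen_fun M (wait 0) t = 1"
  by (simp add: prob_gen_fun_def waiting_time_0 zero_enat_def prob_space)

lemma prob_gen_fun_wait_eq:
  fixes t :: complex
  defines "A \<equiv> of_real (q ^ l1 * p ^ l2) * t ^ (l1 + l2) * (1 - (of_real q * t) ^ (k1 - l1 + 1))"
  assumes t: "cmod t \<le> 1"
  shows "prob_gen_fun M (wait r) t = (A / (1 - t + A)) ^ r"
proof -
  have rec: "prob_gen_fun M (wait (Suc r)) t * (1 - t + A) = A * prob_gen_fun M (wait r) t" for r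
    unfolding A_def by (rule prob_gen_fun_rec[OF t])
  have nz: "1 - t + A \<noteq> 0"
  proof
    assume zero: "1 - t + A = 0"
    \<comment> \<open>At \<open>r = 0\<close> the recurrence reads \<open>0 = A * 1\<close>. So a
      zero denominator forces \<open>t = 1\<close>, where \<open>A\<close> is in fact
      positive.\<close>
    then have "A = 0"
      using rec[of 0] prob_gen_fun_wait_0[OF t] by simp
    with zero have "t = 1" by simp
    have "A = of_real (q ^ l1 * p ^ l2 * (1 - q ^ (k1 - l1 + 1)))"
      unfolding A_def \<open>t = 1\<close> by simp
    with \<open>A = 0\<close> have "q ^ l1 * p ^ l2 * (1 - q ^ (k1 - l1 + 1)) = 0"
      by (simp only: of_real_eq_0_iff)
    moreover have "0 < q" "q < 1" using q_eq p_pos p_less by auto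
    moreover from this have "q ^ (k1 - l1 + 1) < 1"
      using power_Suc_less_one[of q "k1 - l1"] by simp
    ultimately show False using p_pos by simp
  qed
  show ?thesis
  proof (induction r)
    case 0
    then show ?case by (simp add: prob_gen_fun_wait_0[OF t])
  next
    case (Suc r)
    from rec[of r] nz have "prob_gen_fun M (wait (Suc r)) t = A / (1 - t + A) * prob_gen_fun M (wait r) t"
      by (simp add: eq_divide_eq)
    with Suc show ?case by simp
  qed
qed

end

theorem theorem2p3:
  fixes M :: "'a measure" and \<zeta> :: "nat \<Rightarrow> 'a \<Rightarrow> nat"
    and l1 k1 l2 l m1 :: nat and p q a :: real
    and \<rho> :: "nat \<Rightarrow> 'a \<Rightarrow> enat"
    and H :: "nat \<Rightarrow> complex \<Rightarrow> complex"
    and g :: "nat \<Rightarrow> int \<Rightarrow> real"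
    and \<mu> :: "nat \<Rightarrow> nat \<Rightarrow> real"
  assumes "prob_space M"
    and "prob_space.indep_vars M (\<lambda>_. count_space UNIV) \<zeta> {1..}"
    and "\<And>i. i \<ge> 1 \<Longrightarrow> measure M {\<omega> \<in> space M. \<zeta> i \<omega> = 1} = p"
    and "\<And>i. i \<ge> 1 \<Longrightarrow> measure M {\<omega> \<in> space M. \<zeta> i \<omega> = 0} = q"
    and "0 < p" and "p < 1" and "q = 1 - p"
    and "1 \<le> l1" and "l1 \<le> k1" and "1 \<le> l2"
    and "a = q ^ l1 * p ^ l2" and "l = l1 + l2" and "m1 = k1 - l1 + 1"
    and "\<rho> = (\<lambda>r \<omega>. waiting_time l1 k1 l2 (\<lambda>i. \<zeta> i \<omega>) r)"
    and "H = (\<lambda>r. prob_gen_fun M (\<rho> r))"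
    and "g = (\<lambda>r. point_mass M (\<rho> r))"
    and "\<mu> = (\<lambda>r j. enn2real (raw_moment M (\<rho> r) j))"
  shows
    "(\<forall>r\<ge>1. \<forall>t. cmod t \<le> 1 \<longrightarrow>
        H r t = (of_real a * t ^ l * (1 - (of_real q * t) ^ m1) /
                 (1 - t + of_real a * t ^ l * (1 - (of_real q * t) ^ m1))) ^ r)
     \<and>
     ((\<forall>r\<ge>1. \<forall>m. m \<ge> int (l * r) \<longrightarrow>
        g r m = g r (m - 1)
          + a * (g (r - 1) (m - int l) - g r (m - int l)
                 - q ^ m1 * (g (r - 1) (m - int l - int m1) - g r (m - int l - int m1))))
      \<and> (\<forall>m. g 0 m = (if m = 0 then 1 else 0))
      \<and> (\<forall>r\<ge>1. \<forall>m. m \<le> int (l * r) - 1 \<longrightarrow> g r m = 0))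
     \<and>
     ((\<forall>r j. raw_moment M (\<rho> r) j < \<infinity>)
      \<and> (\<forall>r\<ge>1. \<forall>j\<ge>1.
        \<mu> r j = (\<Sum>k=0..j. real (j choose k) *
          (\<mu> r k + a * (real l ^ (j - k) - q ^ m1 * real (l + m1) ^ (j - k))
                    * (\<mu> (r - 1) k - \<mu> r k))))
      \<and> (\<forall>i. \<mu> 0 i = (if i = 0 then 1 else 0)))"
proof -
  interpret bernoulli_run_pattern M l1 k1 l2 \<zeta> p q
    using assms by (auto simp: bernoulli_run_pattern_def bernoulli_run_pattern_axioms_def run_pattern_def)
  have \<rho>: "\<rho> = (\<lambda>r. wait r)" by (rule assms)
  have H: "H r = prob_gen_fun M (wait r)" for r
    by (simp only: assms(15) \<rho>)
  have g: "g = wait_mass"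
    by (simp only: assms(16) \<rho>)
  \<comment> \<open>The raw moments are finite and the series nonnegative, so
    \<open>enn2real\<close> recovers the series exactly.\<close>
  have \<mu>: "\<mu> = moment"
    by (simp only: assms(17) \<rho> raw_moment_wait) (simp add: moment_nonneg)
  note params = assms(11-13)
  have H_eq: "H r t = (of_real a * t ^ l * (1 - (of_real q * t) ^ m1) /
       (1 - t + of_real a * t ^ l * (1 - (of_real q * t) ^ m1))) ^ r" if "cmod t \<le> 1" for r t
    using prob_gen_fun_wait_eq[OF that] by (simp only: H params)
  have rec: "g r m = g r (m - 1)
          + a * (g (r - 1) (m - int l) - g r (m - int l)
                 - q ^ m1 * (g (r - 1) (m - int l - int m1) - g r (m - int l - int m1)))"
    if "r \<ge> 1" for r m
  proof -
    from that obtain r' where "r = Suc r'" by (cases r) auto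
    then show ?thesis
      using wait_mass_rec[of r' m] unfolding g params by (simp only: diff_Suc_1)
  qed
  have zero: "g r m = 0" if "m \<le> int (l * r) - 1" for r m
    unfolding g by (rule wait_mass_eq_0) (use that params in simp)
  have mom: "\<mu> r j = (\<Sum>k=0..j. real (j choose k) *
          (\<mu> r k + a * (real l ^ (j - k) - q ^ m1 * real (l + m1) ^ (j - k))
                    * (\<mu> (r - 1) k - \<mu> r k)))" if "r \<ge> 1" for r j
  proof -
    from that obtain r' where "r = Suc r'" by (cases r) auto
    then show ?thesis
      using moment_rec[of r' j] unfolding \<mu> params by (simp only: diff_Suc_1)
  qed
  have fin: "raw_moment M (\<rho> r) j < \<infinity>" for r j
    by (simp add: \<rho> raw_moment_wait)
  have g0: "g 0 m = (if m = 0 then 1 else 0)" for m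
    by (simp only: g wait_mass_0)
  have \<mu>0: "\<mu> 0 i = (if i = 0 then 1 else 0)" for i
    by (simp only: \<mu> moment_0)
  show ?thesis
    by (intro conjI allI impI; (rule H_eq rec g0 zero fin mom \<mu>0, assumption?))
qed

end
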